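(* Let $G$ be a finite simple graph with $n=|V(G)|$ vertices. For $k\ge 1$ let $S_k(G)$ denote the number of subgraphs of $G$ isomorphic to the star $K_{1,k}$, and for $k\ge 0$ let $f_k$ denote the number of vertices of $G$ of degree $k$ (so $f_k=0$ for $k\ge n$). Then \[ 2S_1(G)+\sum_{i=2}^{n-1}(-1)^{i-1} S_i(G)=\sum_{i=1}^{n-1} f_i, \] and for every positive integer $m$, \[ 2S_1(G)+\sum_{i=2}^{n-1}(-1)^{i-1} i^m S_i(G)=\sum_{k=1}^{m}(-1)^{k-1} k!\left\{ {m \atop k}\right\} f_k . \]
   Context: $K_{1,k}$ is the star graph with one center and $k$ leaves; $S_k(G)$ counts its (not necessarily induced) copies in $G$, so $S_1(G)$ is the number of edges. $\left\{ {m \atop k}\right\}$ denotes the Stirling number of the second kind (number of partitions of an $m$-element set into $k$ nonempty blocks). Here $m$ is just an integer parameter, not the number of edges. *)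

theory Defs
  imports Main "HOL-Combinatorics.Stirling"
begin

text \<open>
  An undirected graph is a pair of a vertex set and an edge set; an edge of a simple graph
  is a two-element set of vertices.
\<close>

type_synonym 'a graph = "'a set \<times> 'a set set"

abbreviation verts :: "'a graph \<Rightarrow> 'a set" where
  "verts G \<equiv> fst G"

abbreviation edges :: "'a graph \<Rightarrow> 'a set set" where
  "edges G \<equiv> snd G"

definition finite_simple_graph :: "'a graph \<Rightarrow> bool" where
  "finite_simple_graph G \<longleftrightarrow>
     finite (verts G) \<and> (\<forall>e\<in>edges G. e \<subseteq> verts G \<and> card e = 2)"

definition subgraph :: "'a graph \<Rightarrow> 'a graph \<Rightarrow> bool" where
  "subgraph H G \<longleftrightarrow>
     finite_simple_graph H \<and> verts H \<subseteq> verts G \<and> edges H \<subseteq> edges G"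

definition graph_iso :: "'a graph \<Rightarrow> 'b graph \<Rightarrow> bool" where
  "graph_iso G H \<longleftrightarrow>
     (\<exists>\<phi>. bij_betw \<phi> (verts G) (verts H) \<and>
       (\<forall>u\<in>verts G. \<forall>v\<in>verts G. {u, v} \<in> edges G \<longleftrightarrow> {\<phi> u, \<phi> v} \<in> edges H))"

text \<open>The star with centre \<open>0\<close> and leaves \<open>1, \<dots>, k\<close>.\<close>

definition star :: "nat \<Rightarrow> nat graph" where
  "star k = ({0..k}, {{0, i} | i. i \<in> {1..k}})"

definition star_count :: "nat \<Rightarrow> 'a graph \<Rightarrow> nat" where
  "star_count k G = card {H. subgraph H G \<and> graph_iso H (star k)}"

definition degree :: "'a graph \<Rightarrow> 'a \<Rightarrow> nat" where
  "degree G v = card {e \<in> edges G. v \<in> e}"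

definition degree_count :: "nat \<Rightarrow> 'a graph \<Rightarrow> nat" where
  "degree_count k G = card {v \<in> verts G. degree G v = k}"

end

theory Submission
  imports Defs
begin

text \<open>
  A copy of \<open>K\<^bsub>1,k\<^esub>\<close> (\<open>k \<ge> 1\<close>) is determined by its edge set, a set of \<open>k\<close> edges through a common
  vertex; that vertex is unique if \<open>k \<ge> 2\<close>, and there are two choices if \<open>k = 1\<close>. Hence
  \<open>S\<^sub>k = \<Sum>\<^sub>v (deg v choose k)\<close> for \<open>k \<ge> 2\<close> and \<open>2 S\<^sub>1 = \<Sum>\<^sub>v deg v\<close>. Exchanging the
  sums, both identities reduce to \<open>\<Sum>\<^sub>i (-1)\<^sup>i (d choose i) i\<^sup>m = (-1)\<^sup>d d! (Stirling m d)\<close> at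
  \<open>d = deg v\<close>, the first one being the case \<open>m = 0\<close>.
\<close>

section \<open>Alternating sums of binomial coefficients times powers\<close>

text \<open>The absorption \<open>i * (d choose i) = d * (d choose i) - d * (d - 1 choose i)\<close>
  lowers the power of \<open>i\<close> by one and reproduces the recurrence
  \<open>Stirling (Suc m) d = d * Stirling m d + Stirling m (d - 1)\<close>. The induction
  hypothesis is used at both \<open>d\<close> and \<open>d - 1\<close>, hence the arbitrary
  \<open>d\<close>.\<close>

lemma alternating_sum_choose_power:
  "(\<Sum>i\<le>d. (-1) ^ i * int (d choose i) * int i ^ m) = (-1) ^ d * int (fact d) * int (Stirling m d)"
proof (induction m arbitrary: d)
  case 0
  show ?case
  proof (cases d)
    case (Suc e)
    then show ?thesis using choose_alternating_sum[of d, where 'a = int] by simp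
  qed simp
next
  case (Suc m)
  show ?case
  proof (cases d)
    case (Suc e)
    have absorb: "int i * int (d choose i) = int d * int (d choose i) - int d * int (e choose i)"
      if "i \<le> d" for i
    proof -
      have "(d - i) * (d choose i) = d * (e choose i)"
        using binomial_absorb_comp[of d i] Suc by simp
      then have "int (d - i) * int (d choose i) = int d * int (e choose i)"
        by (metis of_nat_mult)
      with that show ?thesis by (simp add: of_nat_diff algebra_simps)
    qed
    have "(\<Sum>i\<le>d. (-1) ^ i * int (d choose i) * int i ^ Suc m)
        = (\<Sum>i\<le>d. (-1) ^ i * (int i * int (d choose i)) * int i ^ m)"
      by (simp add: mult_ac)
    also have "\<dots> = (\<Sum>i\<le>d. (-1) ^ i * (int d * int (d choose i) - int d * int (e choose i)) * int i ^ m)"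
      using absorb by (intro sum.cong) auto
    also have "\<dots> = int d * (\<Sum>i\<le>d. (-1) ^ i * int (d choose i) * int i ^ m)
        - int d * (\<Sum>i\<le>d. (-1) ^ i * int (e choose i) * int i ^ m)"
      by (simp add: sum_distrib_left sum_subtractf[symmetric] algebra_simps)
    \<comment> \<open>The term \<open>i = d\<close> drops out because \<open>e choose d = 0\<close>,
      so the hypothesis applies at \<open>e\<close>.\<close>
    also have "(\<Sum>i\<le>d. (-1) ^ i * int (e choose i) * int i ^ m)
        = (\<Sum>i\<le>e. (-1) ^ i * int (e choose i) * int i ^ m)"
      using Suc by simp
    finally show ?thesis
      unfolding Suc.IH using Suc by (simp add: algebra_simps)
  qed (simp add: sum.atMost_shift)
qed

text \<open>Terms with \<open>i > d\<close> vanish, so one bound \<open>N\<close> can serve all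
  degrees. The removed term \<open>i = 0\<close> is \<open>0 ^ m\<close>, which is 1 exactly when
  \<open>m = 0\<close>; this is the source of the conditional.\<close>

lemma alternating_sum_choose_power_pos:
  assumes "d \<le> N"
  shows "(\<Sum>i=1..N. (-1) ^ (i - 1) * int i ^ m * int (d choose i))
    = (if m = 0 then 1 else 0) - (-1) ^ d * int (fact d) * int (Stirling m d)"
proof -
  have "(\<Sum>i\<le>d. (-1) ^ i * int (d choose i) * int i ^ m)
      = (\<Sum>i=0..N. (-1) ^ i * int (d choose i) * int i ^ m)"
    using assms by (intro sum.mono_neutral_left) auto
  also have "\<dots> = 0 ^ m + (\<Sum>i=1..N. (-1) ^ i * int (d choose i) * int i ^ m)"
    by (simp add: sum.atLeast_Suc_atMost)
  also have "(\<Sum>i=1..N. (-1) ^ i * int (d choose i) * int i ^ m)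
      = - (\<Sum>i=1..N. (-1) ^ (i - 1) * int i ^ m * int (d choose i))"
    unfolding sum_negf[symmetric]
  proof (intro sum.cong refl)
    fix i assume "i \<in> {1..N}"
    then obtain j where "i = Suc j" by (cases i) auto
    then show "(-1) ^ i * int (d choose i) * int i ^ m = - ((-1) ^ (i - 1) * int i ^ m * int (d choose i))"
      by (simp add: mult_ac)
  qed
  finally show ?thesis
    unfolding alternating_sum_choose_power by (simp add: power_0_left)
qed

section \<open>Graphs isomorphic to a star\<close>

lemma star_edge_iff:
  assumes "a \<le> k" "b \<le> k"
  shows "{a, b} \<in> edges (star k) \<longleftrightarrow> (a = 0) \<noteq> (b = 0)"
  using assms by (auto simp: star_def doubleton_eq_iff)

text \<open>The vertex sent to \<open>0\<close> serves as \<open>c\<close>. Conversely any bijection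
  from the other vertices to the leaves, extended by sending \<open>c\<close> to \<open>0\<close>,
  is an isomorphism, since adjacency depends only on which endpoints equal \<open>c\<close>. For
  \<open>k = 1\<close> either end can be \<open>c\<close>.\<close>

lemma graph_iso_star_iff:
  "graph_iso H (star k) \<longleftrightarrow> finite (verts H) \<and> card (verts H) = Suc k \<and>
     (\<exists>c\<in>verts H. \<forall>u\<in>verts H. \<forall>v\<in>verts H. {u, v} \<in> edges H \<longleftrightarrow> (u = c) \<noteq> (v = c))"
    (is "?L \<longleftrightarrow> ?R")
proof
  assume ?L
  then obtain \<phi> where bij: "bij_betw \<phi> (verts H) {0..k}"
    and edge: "\<And>u v. u \<in> verts H \<Longrightarrow> v \<in> verts H \<Longrightarrow> {u, v} \<in> edges H \<longleftrightarrow> {\<phi> u, \<phi> v} \<in> edges (star k)"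
    by (auto simp: graph_iso_def star_def)
  have le: "\<phi> u \<le> k" if "u \<in> verts H" for u
    using bij that by (auto dest: bij_betwE)
  obtain c where c: "c \<in> verts H" "\<phi> c = 0"
    using bij by (metis atLeastAtMost_iff bij_betw_imp_surj_on imageE le0)
  have zero: "\<phi> u = 0 \<longleftrightarrow> u = c" if "u \<in> verts H" for u
    using bij c that by (auto simp: bij_betw_def inj_on_def)
  show ?R
  proof (intro conjI bexI[of _ c] ballI)
    show "finite (verts H)" "card (verts H) = Suc k"
      using bij_betw_finite[OF bij] bij_betw_same_card[OF bij] by auto
    fix u v assume "u \<in> verts H" "v \<in> verts H"
    then show "{u, v} \<in> edges H \<longleftrightarrow> (u = c) \<noteq> (v = c)"
      using edge[of u v] star_edge_iff[OF le[of u] le[of v]] zero by simp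
  qed (fact c(1))
next
  assume R: ?R
  then obtain c where c: "c \<in> verts H"
    and edge: "\<And>u v. u \<in> verts H \<Longrightarrow> v \<in> verts H \<Longrightarrow> {u, v} \<in> edges H \<longleftrightarrow> (u = c) \<noteq> (v = c)"
    by blast
  have "card (verts H - {c}) = card {1..k}" "finite (verts H - {c})"
    using R c by auto
  then obtain g where g: "bij_betw g (verts H - {c}) {1..k}"
    by (meson finite_atLeastAtMost finite_same_card_bij)
  define \<phi> where "\<phi> = g(c := 0)"
  have "bij_betw \<phi> (verts H - {c}) {1..k}"
    using g by (rule bij_betw_cong[THEN iffD1, rotated]) (simp add: \<phi>_def)
  moreover have "bij_betw \<phi> {c} {0}"
    by (simp add: \<phi>_def bij_betw_def)
  ultimately have "bij_betw \<phi> ((verts H - {c}) \<union> {c}) ({1..k} \<union> {0})"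
    by (rule bij_betw_combine) auto
  moreover have "(verts H - {c}) \<union> {c} = verts H" "{1..k} \<union> {0} = {0..k}"
    using c by auto
  ultimately have bij: "bij_betw \<phi> (verts H) {0..k}" by simp
  have le: "\<phi> u \<le> k" if "u \<in> verts H" for u
    using bij that by (auto dest: bij_betwE)
  have zero: "\<phi> u = 0 \<longleftrightarrow> u = c" if "u \<in> verts H" for u
    using inj_on_eq_iff[OF bij_betw_imp_inj_on[OF bij] that c] by (simp add: \<phi>_def)
  have "{u, v} \<in> edges H \<longleftrightarrow> {\<phi> u, \<phi> v} \<in> edges (star k)" if "u \<in> verts H" "v \<in> verts H" for u v
    using that edge[of u v] star_edge_iff[OF le[of u] le[of v]] zero by simp
  moreover have "verts (star k) = {0..k}"
    by (simp add: star_def)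
  ultimately show ?L
    unfolding graph_iso_def using bij by auto
qed

section \<open>Star subgraphs as sets of edges through a common vertex\<close>

context
  fixes G :: "'a graph"
  assumes G: "finite_simple_graph G"
begin

lemma finite_verts: "finite (verts G)"
  and edge_subset: "e \<in> edges G \<Longrightarrow> e \<subseteq> verts G"
  and card_edge: "e \<in> edges G \<Longrightarrow> card e = 2"
  using G by (auto simp: finite_simple_graph_def)

lemma finite_edges: "finite (edges G)"
  using edge_subset by (intro finite_subset[OF _ finite_Pow_iff[THEN iffD2, OF finite_verts]]) auto

lemma edge_through:
  assumes "e \<in> edges G" "c \<in> e"
  obtains x where "x \<noteq> c" "e = {c, x}"
proof -
  obtain a b where "e = {a, b}" "a \<noteq> b"
    using card_edge[OF assms(1)] by (auto simp: card_2_iff)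
  with assms(2) that[of a] that[of b] show ?thesis by (auto simp: insert_commute)
qed

text \<open>The map sending \<open>x\<close> to \<open>{v, x}\<close> covers the edges at
  \<open>v\<close> from the other vertices. The bound ensures that sums cut off at
  \<open>n - 1\<close> lose nothing.\<close>

lemma degree_le_card_verts:
  assumes "v \<in> verts G"
  shows "degree G v \<le> card (verts G) - 1"
proof -
  have "{e \<in> edges G. v \<in> e} \<subseteq> (\<lambda>x. {v, x}) ` (verts G - {v})"
  proof
    fix e assume e: "e \<in> {e \<in> edges G. v \<in> e}"
    then obtain x where "x \<noteq> v" "e = {v, x}" by (auto elim: edge_through)
    with e edge_subset[of e] show "e \<in> (\<lambda>x. {v, x}) ` (verts G - {v})" by auto
  qed
  then have "degree G v \<le> card (verts G - {v})"
    unfolding degree_def using finite_verts by (intro surj_card_le) auto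
  with assms show ?thesis using finite_verts by simp
qed

text \<open>In both directions the edges are the injective image of the vertices other than
  \<open>c\<close> under \<open>x\<close> going to \<open>{c, x}\<close>, so \<open>k\<close> edges
  correspond to \<open>k + 1\<close> vertices.\<close>

lemma star_subgraph_iff:
  assumes "k \<ge> 1"
  shows "subgraph H G \<and> graph_iso H (star k) \<longleftrightarrow>
    edges H \<subseteq> edges G \<and> card (edges H) = k \<and> (\<exists>c. \<forall>e\<in>edges H. c \<in> e) \<and> verts H = \<Union>(edges H)"
    (is "?L \<longleftrightarrow> ?R")
proof
  assume L: ?L
  then obtain c where c: "c \<in> verts H"
    and edge: "\<And>u v. u \<in> verts H \<Longrightarrow> v \<in> verts H \<Longrightarrow> {u, v} \<in> edges H \<longleftrightarrow> (u = c) \<noteq> (v = c)"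
    unfolding graph_iso_star_iff by blast
  have card: "finite (verts H)" "card (verts H) = Suc k" and sub: "edges H \<subseteq> edges G"
    and H: "\<And>e. e \<in> edges H \<Longrightarrow> e \<subseteq> verts H \<and> card e = 2"
    using L by (auto simp: graph_iso_star_iff subgraph_def finite_simple_graph_def)
  have E: "edges H = (\<lambda>x. {c, x}) ` (verts H - {c})"
  proof
    show "edges H \<subseteq> (\<lambda>x. {c, x}) ` (verts H - {c})"
    proof
      fix e assume e: "e \<in> edges H"
      then obtain a b where ab: "e = {a, b}" using H by (meson card_2_iff)
      then have "a \<in> verts H" "b \<in> verts H" using H e by auto
      then show "e \<in> (\<lambda>x. {c, x}) ` (verts H - {c})"
        using edge[of a b] e ab by (auto simp: insert_commute)
    qed
  qed (use c edge in auto)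
  have "inj_on (\<lambda>x. {c, x}) (verts H - {c})"
    by (auto simp: inj_on_def doubleton_eq_iff)
  then have "card (edges H) = k"
    using E card c by (simp add: card_image)
  moreover have "card (verts H - {c}) = k"
    using card c by simp
  \<comment> \<open>A leaf exists because \<open>k \<ge> 1\<close>, so \<open>c\<close> itself lies
    on an edge; for \<open>k = 0\<close> it would be isolated and invisible to the edge set.\<close>
  then have "verts H - {c} \<noteq> {}"
    using assms by (metis card.empty not_one_le_zero)
  then have "verts H = \<Union>(edges H)"
    using E c by auto
  moreover have "\<forall>e\<in>edges H. c \<in> e"
    using E by auto
  ultimately show ?R using sub by blast
next
  assume R: ?R
  then obtain c where c: "\<And>e. e \<in> edges H \<Longrightarrow> c \<in> e" by blast
  have sub: "edges H \<subseteq> edges G" and V: "verts H = \<Union>(edges H)" and card: "card (edges H) = k"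
    using R by auto
  have ne: "edges H \<noteq> {}" using card assms by auto
  then have cV: "c \<in> verts H" using c V by auto
  have E: "edges H = (\<lambda>x. {c, x}) ` (verts H - {c})"
  proof
    show "edges H \<subseteq> (\<lambda>x. {c, x}) ` (verts H - {c})"
    proof
      fix e assume e: "e \<in> edges H"
      then have "e \<in> edges G" "c \<in> e" using c sub by auto
      then obtain x where "x \<noteq> c" "e = {c, x}" by (rule edge_through)
      then show "e \<in> (\<lambda>x. {c, x}) ` (verts H - {c})" using e V by auto
    qed
    show "(\<lambda>x. {c, x}) ` (verts H - {c}) \<subseteq> edges H"
    proof (rule image_subsetI)
      fix x assume x: "x \<in> verts H - {c}"
      then obtain e where e: "e \<in> edges H" "x \<in> e" using V by auto
      then have "e \<in> edges G" "c \<in> e" using c sub by auto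
      then obtain y where "e = {c, y}" by (rule edge_through)
      with e x show "{c, x} \<in> edges H" by auto
    qed
  qed
  have VG: "verts H \<subseteq> verts G" using V sub edge_subset by auto
  have fin: "finite (verts H)" using VG finite_verts finite_subset by blast
  have "inj_on (\<lambda>x. {c, x}) (verts H - {c})"
    by (auto simp: inj_on_def doubleton_eq_iff)
  then have "card (verts H - {c}) = k"
    using E card card_image by metis
  then have "card (verts H) = Suc k"
    using card_Suc_Diff1[OF fin cV] by simp
  moreover have "\<forall>u\<in>verts H. \<forall>v\<in>verts H. {u, v} \<in> edges H \<longleftrightarrow> (u = c) \<noteq> (v = c)"
    unfolding E image_iff doubleton_eq_iff by blast
  ultimately have "graph_iso H (star k)"
    unfolding graph_iso_star_iff using fin cV by blast
  moreover have "subgraph H G"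
    unfolding subgraph_def finite_simple_graph_def
    using VG sub fin card_edge by (simp add: V Sup_upper subsetD)
  ultimately show ?L by blast
qed

text \<open>The edge set determines the whole copy, so copies and admissible edge sets are in
  bijection.\<close>

lemma star_count_eq_card_edge_sets:
  assumes "k \<ge> 1"
  shows "star_count k G = card {F. F \<subseteq> edges G \<and> card F = k \<and> (\<exists>c. \<forall>e\<in>F. c \<in> e)}"
    (is "_ = card ?F")
proof -
  have "{H. subgraph H G \<and> graph_iso H (star k)} = (\<lambda>F. (\<Union>F, F)) ` ?F"
    unfolding star_subgraph_iff[OF assms] by (force simp: image_iff)
  moreover have "inj_on (\<lambda>F. (\<Union>F, F)) ?F"
    by (auto simp: inj_on_def)
  ultimately show ?thesis
    unfolding star_count_def by (simp add: card_image)
qed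

section \<open>Star counts in terms of degrees\<close>

text \<open>Every single edge is a star, and the handshake double count of incidences meets each
  edge at its two ends.\<close>

lemma star_count_one: "2 * star_count 1 G = (\<Sum>v\<in>verts G. degree G v)"
proof -
  have "{F. F \<subseteq> edges G \<and> card F = 1 \<and> (\<exists>c. \<forall>e\<in>F. c \<in> e)} = (\<lambda>e. {e}) ` edges G"
  proof -
    have "e \<noteq> {}" if "e \<in> edges G" for e using card_edge[OF that] by auto
    then show ?thesis by (auto simp: card_1_singleton_iff)
  qed
  then have "star_count 1 G = card (edges G)"
    by (simp add: star_count_eq_card_edge_sets card_image inj_on_def)
  moreover have "(\<Sum>v\<in>verts G. degree G v) = 2 * card (edges G)"
    unfolding degree_def
  proof (rule sum_multicount)
    show "\<forall>e\<in>edges G. card {v \<in> verts G. v \<in> e} = 2"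
    proof
      fix e assume e: "e \<in> edges G"
      then have "{v \<in> verts G. v \<in> e} = e" using edge_subset by auto
      then show "card {v \<in> verts G. v \<in> e} = 2" using card_edge[OF e] by simp
    qed
  qed (use finite_verts finite_edges in auto)
  ultimately show ?thesis by simp
qed

text \<open>The edge sets are sorted by centre. The classes are disjoint because two distinct common
  vertices \<open>v\<close>, \<open>w\<close> force every edge to be \<open>{v, w}\<close>, leaving
  at most one edge, against \<open>k \<ge> 2\<close>.\<close>

lemma star_count_eq_sum_choose:
  assumes "k \<ge> 2"
  shows "star_count k G = (\<Sum>v\<in>verts G. degree G v choose k)"
proof -
  define A where "A v = {F. F \<subseteq> {e \<in> edges G. v \<in> e} \<and> card F = k}" for v
  have "{F. F \<subseteq> edges G \<and> card F = k \<and> (\<exists>c. \<forall>e\<in>F. c \<in> e)} = (\<Union>v\<in>verts G. A v)"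
  proof (intro equalityI subsetI)
    fix F assume F: "F \<in> {F. F \<subseteq> edges G \<and> card F = k \<and> (\<exists>c. \<forall>e\<in>F. c \<in> e)}"
    then obtain c where c: "\<forall>e\<in>F. c \<in> e" by auto
    \<comment> \<open>The common element \<open>c\<close> is a priori any element of the type; a
      member of \<open>F\<close> places it in the graph.\<close>
    have "F \<noteq> {}" using F assms by auto
    then have "c \<in> verts G" using c F edge_subset by blast
    then show "F \<in> (\<Union>v\<in>verts G. A v)" using c F by (auto simp: A_def)
  qed (auto simp: A_def)
  then have "star_count k G = card (\<Union>v\<in>verts G. A v)"
    using assms by (simp add: star_count_eq_card_edge_sets)
  also have "\<dots> = (\<Sum>v\<in>verts G. card (A v))"
  proof (rule card_UN_disjoint)
    show "\<forall>v\<in>verts G. finite (A v)"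
      using finite_edges by (auto simp: A_def intro: finite_subset[of _ "Pow (edges G)"])
    show "\<forall>v\<in>verts G. \<forall>w\<in>verts G. v \<noteq> w \<longrightarrow> A v \<inter> A w = {}"
    proof (intro ballI impI)
      fix v w :: 'a assume "v \<noteq> w"
      have False if F: "F \<in> A v" "F \<in> A w" for F
      proof -
        have "e = {v, w}" if "e \<in> F" for e
        proof -
          have "e \<in> edges G" "v \<in> e" "w \<in> e" using that F by (auto simp: A_def)
          with \<open>v \<noteq> w\<close> show ?thesis by (auto elim: edge_through)
        qed
        then have "F \<subseteq> {{v, w}}" by auto
        then have "card F \<le> 1" by (metis card.empty card_mono finite.emptyI finite.insertI is_singletonI is_singleton_altdef)
        with F assms show False by (auto simp: A_def)
      qed
      then show "A v \<inter> A w = {}" by auto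
    qed
  qed (rule finite_verts)
  also have "\<dots> = (\<Sum>v\<in>verts G. degree G v choose k)"
    using finite_edges by (simp add: A_def degree_def n_subsets)
  finally show ?thesis .
qed

section \<open>From sums over vertices to sums over degrees\<close>

text \<open>Vertices are grouped by degree. Since \<open>K\<close> has to contain only the occurring
  degrees where \<open>g\<close> is nonzero, it can be \<open>{1..n-1}\<close> for one identity and
  \<open>{1..m}\<close> for the other.\<close>

lemma sum_degree_eq_sum_degree_count:
  fixes g :: "nat \<Rightarrow> int"
  assumes "finite K" "\<And>v. v \<in> verts G \<Longrightarrow> degree G v \<notin> K \<Longrightarrow> g (degree G v) = 0"
  shows "(\<Sum>v\<in>verts G. g (degree G v)) = (\<Sum>k\<in>K. g k * int (degree_count k G))"
proof -
  have "(\<Sum>v\<in>verts G. g (degree G v)) = (\<Sum>v\<in>verts G. \<Sum>k\<in>K. if degree G v = k then g k else 0)"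
    using assms by (intro sum.cong) (auto simp: sum.delta)
  also have "\<dots> = (\<Sum>k\<in>K. \<Sum>v\<in>verts G. if degree G v = k then g k else 0)"
    by (rule sum.swap)
  also have "\<dots> = (\<Sum>k\<in>K. g k * int (degree_count k G))"
    using finite_verts by (simp add: degree_count_def sum.If_cases Int_def conj_commute mult.commute)
  finally show ?thesis .
qed

text \<open>After the sums are exchanged, each vertex contributes one alternating binomial sum. As
  \<open>int i ^ 0 = 1\<close>, the case \<open>m = 0\<close> has the left side of the first
  identity.\<close>

lemma alternating_sum_star_count:
  "2 * int (star_count 1 G) + (\<Sum>i=2..card (verts G) - 1. (-1) ^ (i - 1) * int i ^ m * int (star_count i G))
    = (\<Sum>v\<in>verts G. (if m = 0 then 1 else 0)
        - (-1) ^ degree G v * int (fact (degree G v)) * int (Stirling m (degree G v)))"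
proof -
  define N where "N = card (verts G) - 1"
  define T where "T v i = (-1) ^ (i - 1) * int i ^ m * int (degree G v choose i)" for v i
  \<comment> \<open>The degree is exactly the term \<open>i = 1\<close>, which the handshake
    supplies. If \<open>N = 0\<close> there is no such term, but then the degree is 0.\<close>
  have split: "int (degree G v) + (\<Sum>i=2..N. T v i) = (\<Sum>i=1..N. T v i)" if "v \<in> verts G" for v
  proof (cases "N = 0")
    case True
    then show ?thesis using degree_le_card_verts[OF that] by (simp add: N_def)
  next
    case False
    then show ?thesis by (subst (2) sum.atLeast_Suc_atMost) (auto simp: T_def numeral_2_eq_2)
  qed
  have "2 * int (star_count 1 G) = (\<Sum>v\<in>verts G. int (degree G v))"
    using arg_cong[OF star_count_one, of int] by simp
  moreover have "(\<Sum>i=2..N. (-1) ^ (i - 1) * int i ^ m * int (star_count i G))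
      = (\<Sum>i=2..N. \<Sum>v\<in>verts G. T v i)"
    by (intro sum.cong) (auto simp: star_count_eq_sum_choose T_def sum_distrib_left)
  moreover have "\<dots> = (\<Sum>v\<in>verts G. \<Sum>i=2..N. T v i)"
    by (rule sum.swap)
  ultimately have "2 * int (star_count 1 G) + (\<Sum>i=2..N. (-1) ^ (i - 1) * int i ^ m * int (star_count i G))
      = (\<Sum>v\<in>verts G. \<Sum>i=1..N. T v i)"
    using split by (simp add: sum.distrib[symmetric])
  also have "\<dots> = (\<Sum>v\<in>verts G. (if m = 0 then 1 else 0)
        - (-1) ^ degree G v * int (fact (degree G v)) * int (Stirling m (degree G v)))"
    unfolding T_def
    by (intro sum.cong refl alternating_sum_choose_power_pos) (use degree_le_card_verts in \<open>simp add: N_def\<close>)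
  finally show ?thesis by (simp add: N_def)
qed

end

section \<open>Weights of the degrees for \<open>m = 0\<close> and for
  \<open>m \<ge> 1\<close>\<close>

theorem theorem2:
  fixes G :: "'a graph" and n :: nat
  assumes "finite_simple_graph G"
    and "n = card (verts G)"
  shows "2 * int (star_count 1 G) + (\<Sum>i=2..n-1. (-1) ^ (i - 1) * int (star_count i G))
           = (\<Sum>i=1..n-1. int (degree_count i G)) \<and>
         (\<forall>m::nat. m \<ge> 1 \<longrightarrow>
           2 * int (star_count 1 G) + (\<Sum>i=2..n-1. (-1) ^ (i - 1) * int i ^ m * int (star_count i G))
             = (\<Sum>k=1..m. (-1) ^ (k - 1) * int (fact k) * int (Stirling m k) * int (degree_count k G)))"
proof (intro conjI allI impI)
  note G = assms(1)
  \<comment> \<open>\<open>g m d\<close> is the total contribution of a vertex of degree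
    \<open>d\<close>.\<close>
  define g :: "nat \<Rightarrow> nat \<Rightarrow> int" where
    "g m d = (if m = 0 then 1 else 0) - (-1) ^ d * int (fact d) * int (Stirling m d)" for m d
  have main: "2 * int (star_count 1 G) + (\<Sum>i=2..n-1. (-1) ^ (i - 1) * int i ^ m * int (star_count i G))
      = (\<Sum>k\<in>K. g m k * int (degree_count k G))"
    if "finite K" "\<And>v. v \<in> verts G \<Longrightarrow> degree G v \<notin> K \<Longrightarrow> g m (degree G v) = 0" for m K
    using alternating_sum_star_count[OF G, of m] sum_degree_eq_sum_degree_count[OF G, of K "g m"] that
    by (simp add: g_def assms(2))
  \<comment> \<open>\<open>Stirling 0 d\<close> is 1 at \<open>d = 0\<close> and 0 otherwise, so
    only isolated vertices are cancelled.\<close>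
  have g0: "g 0 d = (if d = 0 then 0 else 1)" for d
    by (cases d) (simp_all add: g_def)
  have "g 0 (degree G v) = 0" if "v \<in> verts G" "degree G v \<notin> {1..n-1}" for v
    using that degree_le_card_verts[OF G that(1)] by (auto simp: g0 assms(2) not_le)
  from main[OF _ this, of "{1..n-1}"]
  show "2 * int (star_count 1 G) + (\<Sum>i=2..n-1. (-1) ^ (i - 1) * int (star_count i G))
      = (\<Sum>i=1..n-1. int (degree_count i G))"
    by (simp add: g0)
  fix m :: nat assume m: "m \<ge> 1"
  \<comment> \<open>For \<open>m \<ge> 1\<close>, \<open>Stirling m d\<close> vanishes at
    \<open>d = 0\<close> and for \<open>d > m\<close>, which gives the range \<open>{1..m}\<close>
    whatever \<open>n\<close> is.\<close>
  have "g m (degree G v) = 0" if "degree G v \<notin> {1..m}" for v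
    using that m by (cases "degree G v"; cases m) (auto simp: g_def)
  from main[OF _ this, of "{1..m}"]
  have "2 * int (star_count 1 G) + (\<Sum>i=2..n-1. (-1) ^ (i - 1) * int i ^ m * int (star_count i G))
      = (\<Sum>k=1..m. g m k * int (degree_count k G))"
    by simp
  also have "\<dots> = (\<Sum>k=1..m. (-1) ^ (k - 1) * int (fact k) * int (Stirling m k) * int (degree_count k G))"
  proof (intro sum.cong refl)
    fix k assume "k \<in> {1..m}"
    \<comment> \<open>Positivity of \<open>k\<close> turns the leading minus sign into
      \<open>(-1) ^ (k - 1)\<close> despite truncated subtraction.\<close>
    then obtain j where "k = Suc j" by (cases k) auto
    with m show "g m k * int (degree_count k G)
        = (-1) ^ (k - 1) * int (fact k) * int (Stirling m k) * int (degree_count k G)"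
      by (simp add: g_def)
  qed
  finally show "2 * int (star_count 1 G) + (\<Sum>i=2..n-1. (-1) ^ (i - 1) * int i ^ m * int (star_count i G))
      = (\<Sum>k=1..m. (-1) ^ (k - 1) * int (fact k) * int (Stirling m k) * int (degree_count k G))" .
qed

end
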